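(* Consider the polynomial ring $\mathbb{C}[a,b,c,d,t]$ in five variables, the polynomials \[ P=(t+c)(ad+bt), \qquad Q=c, \] and the constant-coefficient differential operator \[ \Lambda=\partial_t(\partial_a\partial_d-\partial_b\partial_c) \] acting on $\mathbb{C}[a,b,c,d,t]$. Then \[ \Lambda^m(P^m)=0 \qquad \text{for every integer } m\geq 1, \] but \[ \Lambda^m(QP^m)\neq 0 \qquad \text{for every integer } m\geq 1. \] Consequently, the Generalized Vanishing Conjecture is false in dimension $5$.
   Context: Here $\partial_a,\partial_b,\partial_c,\partial_d,\partial_t$ denote the partial derivatives on $\mathbb{C}[a,b,c,d,t]$ with respect to the indicated variables, $\Lambda^m$ is the $m$-fold composition of $\Lambda$, and $QP^m$ denotes the product of polynomials $Q\cdot P^m$. The Generalized Vanishing Conjecture in dimension $n$ is the following assertion: for every constant-coefficient differential operator $\Lambda\in\mathbb{C}[\partial_1,\ldots,\partial_n]$ (where $\partial_i=\partial/\partial x_i$) and every polynomial $f\in\mathbb{C}[x_1,\ldots,x_n]$, if $\Lambda^m(f^m)=0$ for every $m\geq 1$, then for every fixed polynomial $g\in\mathbb{C}[x_1,\ldots,x_n]$ one has $\Lambda^m(gf^m)=0$ for all sufficiently large $m$. *)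

theory Defs
  imports Complex_Main "HOL-Library.Poly_Mapping"
begin

text \<open>Complex polynomials in countably many variables \<open>x\<^sub>0, x\<^sub>1, \<dots>\<close>: finitely supported maps from
  exponent vectors to coefficients, with the convolution product of \<open>Poly_Mapping\<close>.\<close>

type_synonym cpoly = "(nat \<Rightarrow>\<^sub>0 nat) \<Rightarrow>\<^sub>0 complex"

definition Const :: "complex \<Rightarrow> cpoly" where
  "Const z = Poly_Mapping.single 0 z"

definition X :: "nat \<Rightarrow> cpoly" where
  "X i = Poly_Mapping.single (Poly_Mapping.single i 1) 1"

text \<open>The subring \<open>\<complex>[x\<^sub>0, \<dots>, x\<^sub>n\<^sub>-\<^sub>1]\<close>.\<close>

definition polys :: "nat \<Rightarrow> cpoly set" where
  "polys n = {p. \<forall>\<alpha> \<in> Poly_Mapping.keys p. Poly_Mapping.keys \<alpha> \<subseteq> {..<n}}"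

text \<open>Formal partial derivative: \<open>z x\<^sup>\<alpha> \<mapsto> \<alpha>\<^sub>i z x\<^sup>\<alpha>\<^sup>-\<^sup>e\<^sub>i\<close> on each monomial. The subtraction of exponents
  truncates only when \<open>\<alpha>\<^sub>i = 0\<close>, where the coefficient vanishes.\<close>

definition pd :: "nat \<Rightarrow> cpoly \<Rightarrow> cpoly" where
  "pd i p = (\<Sum>\<alpha> \<in> Poly_Mapping.keys p.
     Poly_Mapping.single (\<alpha> - Poly_Mapping.single i 1)
       (of_nat (Poly_Mapping.lookup \<alpha> i) * Poly_Mapping.lookup p \<alpha>))"

text \<open>\<open>\<complex>[\<partial>\<^sub>0, \<dots>, \<partial>\<^sub>n\<^sub>-\<^sub>1]\<close>: the algebra of operators, under pointwise addition and composition,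
  generated by the scalars and the partial derivatives.\<close>

inductive_set diff_ops :: "nat \<Rightarrow> (cpoly \<Rightarrow> cpoly) set" for n :: nat where
  scalar: "(\<lambda>f. Const z * f) \<in> diff_ops n"
| partial: "i < n \<Longrightarrow> pd i \<in> diff_ops n"
| add: "D \<in> diff_ops n \<Longrightarrow> E \<in> diff_ops n \<Longrightarrow> (\<lambda>f. D f + E f) \<in> diff_ops n"
| comp: "D \<in> diff_ops n \<Longrightarrow> E \<in> diff_ops n \<Longrightarrow> D \<circ> E \<in> diff_ops n"

definition generalized_vanishing_conjecture :: "nat \<Rightarrow> bool" where
  "generalized_vanishing_conjecture n \<longleftrightarrow>
     (\<forall>\<Lambda> \<in> diff_ops n. \<forall>f \<in> polys n.
        (\<forall>m\<ge>1. (\<Lambda> ^^ m) (f ^ m) = 0) \<longrightarrow>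
        (\<forall>g \<in> polys n. eventually (\<lambda>m. (\<Lambda> ^^ m) (g * f ^ m) = 0) sequentially))"

end

theory Submission imports Defs begin

text \<open>On the coefficients of a polynomial multiplied by the factorials of their exponents, partial
  derivatives act as pure shifts. Hence \<open>\<Lambda>\<^sup>m\<close> turns into an alternating binomial sum of shifted
  coefficients. For \<open>P\<^sup>m\<close> only the constant coefficient can survive, and every weighted term of its sum
  equals \<open>\<plusminus> (m!)\<^sup>3 (m choose k)\<close>, so it vanishes. For \<open>Q P\<^sup>m\<close> the coefficient of \<open>t\<close> involves
  \<open>m choose (k + 1)\<close> instead; the missing summand of the alternating sum leaves
  \<open>(-1)\<^sup>m (m!)\<^sup>2 (m + 1)!\<close>.\<close>

section \<open>Factorially weighted coefficients and alternating binomial sums\<close>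

lemma lookup_pd:
  "Poly_Mapping.lookup (pd i p) \<beta> =
    of_nat (Suc (Poly_Mapping.lookup \<beta> i)) * Poly_Mapping.lookup p (\<beta> + Poly_Mapping.single i 1)"
proof -
  let ?e = "Poly_Mapping.single i (1::nat)"
  \<comment> \<open>When \<open>i\<close> does not occur in \<alpha>, truncation may give
    \<open>\<alpha> - ?e = \<beta>\<close>, but the weight is then 0; every other \<alpha> is
    recovered from \<beta>.\<close>
  have *: "(of_nat (Poly_Mapping.lookup \<alpha> i) * Poly_Mapping.lookup p \<alpha> when \<alpha> - ?e = \<beta>) =
      (of_nat (Suc (Poly_Mapping.lookup \<beta> i)) * Poly_Mapping.lookup p (\<beta> + ?e) when \<alpha> = \<beta> + ?e)" for \<alpha>
  proof (cases "Poly_Mapping.lookup \<alpha> i = 0")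
    case True
    then have "\<alpha> \<noteq> \<beta> + ?e"
      by (auto simp: lookup_add)
    with True show ?thesis by simp
  next
    case False
    then have "\<alpha> - ?e = \<beta> \<longleftrightarrow> \<alpha> = \<beta> + ?e"
      by (auto simp: poly_mapping_eq_iff fun_eq_iff lookup_add lookup_minus lookup_single when_def)
    then show ?thesis by (auto simp: when_def lookup_add)
  qed
  show ?thesis
    unfolding pd_def lookup_sum lookup_single * by (simp add: when_def in_keys_iff del: of_nat_Suc)
qed

text \<open>For \<alpha> supported below \<open>n\<close> this is the mixed derivative of
  \<open>p\<close> of order \<alpha>, evaluated at the origin.\<close>

definition dcoeff :: "nat \<Rightarrow> cpoly \<Rightarrow> (nat \<Rightarrow>\<^sub>0 nat) \<Rightarrow> complex" where
  "dcoeff n p \<alpha> = (\<Prod>i<n. fact (Poly_Mapping.lookup \<alpha> i)) * Poly_Mapping.lookup p \<alpha>"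

lemma dcoeff_pd:
  assumes "i < n"
  shows "dcoeff n (pd i p) \<alpha> = dcoeff n p (\<alpha> + Poly_Mapping.single i 1)"
proof -
  let ?\<alpha>' = "\<alpha> + Poly_Mapping.single i 1"
  have "(\<Prod>j\<in>{..<n} - {i}. fact (Poly_Mapping.lookup ?\<alpha>' j)) =
      (\<Prod>j\<in>{..<n} - {i}. fact (Poly_Mapping.lookup \<alpha> j) :: complex)"
    by (rule prod.cong) (auto simp: lookup_add lookup_single)
  moreover have "i \<in> {..<n}" using assms by simp
  ultimately show ?thesis
    by (simp add: dcoeff_def lookup_pd prod.remove[of "{..<n}" i] lookup_add)
qed

lemma dcoeff_diff: "dcoeff n (p - q) \<alpha> = dcoeff n p \<alpha> - dcoeff n q \<alpha>"
  by (simp add: dcoeff_def lookup_minus algebra_simps)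

text \<open>Factorials are nonzero in characteristic 0, so the weighting loses no
  information.\<close>

lemma poly_eq_0_if_dcoeff:
  assumes "\<And>\<alpha>. dcoeff n p \<alpha> = 0"
  shows "p = 0"
proof (rule poly_mapping_eqI)
  fix \<alpha>
  show "Poly_Mapping.lookup p \<alpha> = Poly_Mapping.lookup 0 \<alpha>"
    using assms[of \<alpha>] by (simp add: dcoeff_def)
qed

text \<open>Pascal's rule, in the form of the induction step for expanding a power of
  \<open>S - T\<close> with commuting \<open>S\<close> and \<open>T\<close>; \<open>G k l\<close>
  stands for the value at \<open>S^k T^l\<close>.\<close>

lemma alternating_binomial_sum_Suc:
  fixes G :: "nat \<Rightarrow> nat \<Rightarrow> complex"
  shows "(\<Sum>k\<le>Suc m. (-1) ^ (Suc m + k) * of_nat (Suc m choose k) * G k (Suc m - k)) =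
    (\<Sum>k\<le>m. (-1) ^ (m + k) * of_nat (m choose k) * (G (Suc k) (m - k) - G k (Suc (m - k))))"
proof -
  have "(\<Sum>k\<le>Suc m. (-1) ^ (Suc m + k) * of_nat (Suc m choose k) * G k (Suc m - k)) =
      (-1) ^ Suc m * G 0 (Suc m)
      + (\<Sum>k\<le>m. (-1) ^ (m + k) * of_nat (m choose k) * G (Suc k) (m - k))
      + (\<Sum>k\<le>m. (-1) ^ (m + k) * of_nat (m choose Suc k) * G (Suc k) (m - k))"
    by (simp only: sum.atMost_Suc_shift) (simp add: algebra_simps sum.distrib)
  \<comment> \<open>Reindexing by one flips the sign and adds the term for \<open>k = 0\<close>,
    which the last summand compensates. The new top term \<open>k = Suc m\<close> is 0 because its
    binomial is.\<close>
  also have "(\<Sum>k\<le>m. (-1) ^ (m + k) * of_nat (m choose Suc k) * G (Suc k) (m - k)) =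
      - (\<Sum>k\<le>Suc m. (-1) ^ (m + k) * of_nat (m choose k) * G k (Suc m - k)) + (-1) ^ m * G 0 (Suc m)"
    by (simp only: sum.atMost_Suc_shift) (simp add: sum_negf)
  also have "(\<Sum>k\<le>Suc m. (-1) ^ (m + k) * of_nat (m choose k) * G k (Suc m - k)) =
      (\<Sum>k\<le>m. (-1) ^ (m + k) * of_nat (m choose k) * G k (Suc (m - k)))"
    by (simp add: Suc_diff_le)
  finally show ?thesis
    by (simp add: algebra_simps sum_subtractf)
qed

section \<open>Exponent vectors in the five variables a, b, c, d, t\<close>

definition exps5 :: "nat \<Rightarrow> nat \<Rightarrow> nat \<Rightarrow> nat \<Rightarrow> nat \<Rightarrow> nat \<Rightarrow>\<^sub>0 nat" where
  "exps5 p q r s u = Poly_Mapping.single 0 p + Poly_Mapping.single 1 q + Poly_Mapping.single 2 r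
     + Poly_Mapping.single 3 s + Poly_Mapping.single 4 u"

lemma exps5_add:
  "exps5 p q r s u + exps5 p' q' r' s' u' = exps5 (p + p') (q + q') (r + r') (s + s') (u + u')"
  by (simp add: exps5_def single_add add_ac)

lemma exps5_0: "exps5 0 0 0 0 0 = 0"
  by (simp add: exps5_def)

lemma lookup_exps5:
  "Poly_Mapping.lookup (exps5 p q r s u) i =
    (if i = 0 then p else if i = 1 then q else if i = 2 then r
     else if i = 3 then s else if i = 4 then u else 0)"
  by (auto simp: exps5_def lookup_add lookup_single when_def)

lemma exps5_eq_iff:
  "exps5 p q r s u = exps5 p' q' r' s' u' \<longleftrightarrow> p = p' \<and> q = q' \<and> r = r' \<and> s = s' \<and> u = u'"
proof
  assume "exps5 p q r s u = exps5 p' q' r' s' u'"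
  then have "Poly_Mapping.lookup (exps5 p q r s u) i = Poly_Mapping.lookup (exps5 p' q' r' s' u') i" for i
    by simp
  from this[of 0] this[of 1] this[of 2] this[of 3] this[of 4]
  show "p = p' \<and> q = q' \<and> r = r' \<and> s = s' \<and> u = u'"
    by (simp add: lookup_exps5)
qed simp

text \<open>Exponents are natural numbers and cannot cancel, so \<beta> involves no variable beyond
  the fifth.\<close>

lemma add_exps5_eq_exps5E:
  assumes "\<beta> + exps5 p q r s u = exps5 p' q' r' s' u'"
  obtains p0 q0 r0 s0 u0 where "\<beta> = exps5 p0 q0 r0 s0 u0"
proof
  have "Poly_Mapping.lookup \<beta> i = 0" if "i > 4" for i
    using that arg_cong[OF assms, of "\<lambda>x. Poly_Mapping.lookup x i"]
    by (simp add: lookup_add lookup_exps5)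
  then show "\<beta> = exps5 (Poly_Mapping.lookup \<beta> 0) (Poly_Mapping.lookup \<beta> 1)
      (Poly_Mapping.lookup \<beta> 2) (Poly_Mapping.lookup \<beta> 3) (Poly_Mapping.lookup \<beta> 4)"
    by (intro poly_mapping_eqI) (auto simp: lookup_exps5)
qed

lemma dcoeff_exps5:
  "dcoeff 5 f (exps5 p q r s u) =
    fact p * fact q * fact r * fact s * fact u * Poly_Mapping.lookup f (exps5 p q r s u)"
  by (simp add: dcoeff_def lookup_exps5 eval_nat_numeral lessThan_Suc algebra_simps)

section \<open>Powers of the operator \<Lambda>\<close>

definition cubic_op :: "cpoly \<Rightarrow> cpoly" where
  "cubic_op f = pd 4 (pd 0 (pd 3 f) - pd 1 (pd 2 f))"

lemma dcoeff_cubic_op: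
  "dcoeff 5 (cubic_op f) \<beta> =
    dcoeff 5 f (\<beta> + exps5 1 0 0 1 1) - dcoeff 5 f (\<beta> + exps5 0 1 1 0 1)"
  by (simp add: cubic_op_def dcoeff_pd dcoeff_diff exps5_def add_ac)

lemma dcoeff_cubic_op_funpow:
  "dcoeff 5 ((cubic_op ^^ m) f) \<beta> = (\<Sum>k\<le>m. (-1) ^ (m + k) * of_nat (m choose k)
     * dcoeff 5 f (\<beta> + exps5 k (m - k) (m - k) k m))"
proof (induction m arbitrary: \<beta>)
  case 0
  show ?case by (simp add: exps5_0)
next
  case (Suc m)
  \<comment> \<open>Both shifts raise the exponent of t, so it equals the total number of shifts,
    \<open>Suc m\<close>, however they are split into \<open>k\<close> and \<open>l\<close>.\<close>
  define G where "G k l = dcoeff 5 f (\<beta> + exps5 k l l k (Suc m))" for k l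
  have "dcoeff 5 ((cubic_op ^^ Suc m) f) \<beta> =
      (\<Sum>k\<le>m. (-1) ^ (m + k) * of_nat (m choose k) * (G (Suc k) (m - k) - G k (Suc (m - k))))"
    unfolding funpow.simps comp_def dcoeff_cubic_op Suc
    by (simp add: G_def add.assoc exps5_add algebra_simps sum_subtractf)
  then show ?case
    unfolding alternating_binomial_sum_Suc[symmetric] by (simp add: G_def)
qed

section \<open>Coefficients of \<open>P^m\<close> and \<open>Q * P^m\<close>\<close>

lemma X_power: "X i ^ n = Poly_Mapping.single (Poly_Mapping.single i n) 1"
  by (induction n) (auto simp: X_def mult_single single_add[symmetric])

definition cubic :: cpoly where
  "cubic = (X 4 + X 2) * (X 0 * X 3 + X 1 * X 4)"

text \<open>Two binomial expansions: \<open>k\<close> counts the factors contributing ad,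
  \<open>j\<close> those contributing c.\<close>

lemma cubic_power:
  "cubic ^ m = (\<Sum>k\<le>m. \<Sum>j\<le>m.
     Poly_Mapping.single (exps5 k (m - k) j k ((m - k) + (m - j))) (of_nat (m choose k) * of_nat (m choose j)))"
proof -
  have X_powers:
    "(X 0 * X 3) ^ n = Poly_Mapping.single (exps5 n 0 0 n 0) 1"
    "(X 1 * X 4) ^ n = Poly_Mapping.single (exps5 0 n 0 0 n) 1"
    "X 2 ^ n = Poly_Mapping.single (exps5 0 0 n 0 0) 1"
    "X 4 ^ n = Poly_Mapping.single (exps5 0 0 0 0 n) 1" for n
    by (simp_all add: power_mult_distrib X_power mult_single exps5_def)
  have monomial: "of_nat x * Poly_Mapping.single \<alpha> 1 * Poly_Mapping.single \<beta> 1 *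
        (of_nat y * Poly_Mapping.single \<gamma> 1 * Poly_Mapping.single \<delta> 1) =
      (Poly_Mapping.single (\<alpha> + \<beta> + (\<gamma> + \<delta>)) (of_nat x * of_nat y) :: cpoly)"
    for x y and \<alpha> \<beta> \<gamma> \<delta> :: "nat \<Rightarrow>\<^sub>0 nat"
    by (simp only: single_of_nat[symmetric] mult_single add_0_left mult_1_right)
  \<comment> \<open>The summands are swapped so that \<open>binomial_ring\<close> attaches the index
    \<open>j\<close> to c rather than to t; the swap of factors below makes \<open>k\<close> the
    outer index.\<close>
  have "cubic ^ m = (X 2 + X 4) ^ m * (X 0 * X 3 + X 1 * X 4) ^ m"
    by (simp only: cubic_def power_mult_distrib add.commute)
  also have "\<dots> = (X 0 * X 3 + X 1 * X 4) ^ m * (X 2 + X 4) ^ m"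
    by (rule mult.commute)
  also have "\<dots> = (\<Sum>k\<le>m. \<Sum>j\<le>m.
      Poly_Mapping.single (exps5 k (m - k) j k ((m - k) + (m - j))) (of_nat (m choose k) * of_nat (m choose j)))"
    unfolding binomial_ring X_powers sum_product monomial by (simp add: exps5_add)
  finally show ?thesis .
qed

text \<open>The exponents of a and c determine \<open>k = p\<close> and \<open>j = r\<close>, so at
  most one term contributes. For \<open>r > m\<close> no term does, in agreement with
  \<open>m choose r = 0\<close>.\<close>

lemma lookup_cubic_power:
  "Poly_Mapping.lookup (cubic ^ m) (exps5 p q r s u) =
    (if p + q = m \<and> s = p \<and> r + u = m + q then of_nat (m choose p) * of_nat (m choose r) else 0)"
proof -
  have "Poly_Mapping.lookup (cubic ^ m) (exps5 p q r s u) = (\<Sum>k\<le>m. \<Sum>j\<le>m.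
      if k = p then if j = r then
        if p + q = m \<and> s = p \<and> r + u = m + q then of_nat (m choose p) * of_nat (m choose r) else 0
      else 0 else 0)"
    unfolding cubic_power lookup_sum lookup_single
    by (intro sum.cong refl) (auto simp: exps5_eq_iff when_def)
  also have "\<dots> = (\<Sum>k\<le>m. if k = p then \<Sum>j\<le>m. if j = r then
        if p + q = m \<and> s = p \<and> r + u = m + q then of_nat (m choose p) * of_nat (m choose r) else 0
      else 0 else 0)"
    by (intro sum.cong refl) auto
  finally show ?thesis
    by (auto simp: not_le binomial_eq_0)
qed

lemma lookup_cubic_power_nonzeroE:
  assumes "Poly_Mapping.lookup (cubic ^ m) \<alpha> \<noteq> 0"
  obtains p q r s u where "\<alpha> = exps5 p q r s u"
proof -
  from assms obtain k j where
    "Poly_Mapping.lookup (Poly_Mapping.single (exps5 k (m - k) j k ((m - k) + (m - j)))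
       (of_nat (m choose k) * of_nat (m choose j) :: complex)) \<alpha> \<noteq> 0"
    unfolding cubic_power lookup_sum by (meson sum.neutral)
  then show thesis
    using that by (auto simp: lookup_single when_def split: if_splits)
qed

text \<open>The extra factor c forces \<open>j = m - k - 1\<close>, and symmetry turns
  \<open>m choose j\<close> into \<open>m choose Suc k\<close>.\<close>

lemma lookup_X_mult_cubic_power:
  assumes "k \<le> m"
  shows "Poly_Mapping.lookup (X 2 * cubic ^ m) (exps5 k (m - k) (m - k) k (Suc m)) =
    of_nat (m choose k) * of_nat (m choose Suc k)"
proof -
  have "X 2 = Poly_Mapping.single (exps5 0 0 1 0 0) 1"
    by (simp add: X_def exps5_def)
  then have expand: "X 2 * cubic ^ m = (\<Sum>k'\<le>m. \<Sum>j\<le>m.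
      Poly_Mapping.single (exps5 k' (m - k') (Suc j) k' ((m - k') + (m - j)))
        (of_nat (m choose k') * of_nat (m choose j)))"
    unfolding cubic_power sum_distrib_left
    by (intro sum.cong refl) (simp add: mult_single exps5_add)
  have "Poly_Mapping.lookup (X 2 * cubic ^ m) (exps5 k (m - k) (m - k) k (Suc m)) = (\<Sum>k'\<le>m. \<Sum>j\<le>m.
      if k' = k then if Suc j = m - k then of_nat (m choose k) * of_nat (m choose j) else 0 else 0)"
    unfolding expand lookup_sum lookup_single
    by (intro sum.cong refl) (auto simp: exps5_eq_iff when_def)
  also have "\<dots> = (\<Sum>k'\<le>m. if k' = k then \<Sum>j\<le>m.
      if Suc j = m - k then of_nat (m choose k) * of_nat (m choose j) else 0 else 0)"
    by (intro sum.cong refl) (simp split: if_split)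
  also have "\<dots> = (\<Sum>j\<le>m. if Suc j = m - k then of_nat (m choose k) * of_nat (m choose j) else 0)"
    using assms by (simp only: sum.delta finite_atMost atMost_iff if_True)
  also have "\<dots> = of_nat (m choose k) * of_nat (m choose Suc k)"
  \<comment> \<open>For \<open>k = m\<close> no \<open>j\<close> satisfies \<open>Suc j = 0\<close>,
    and \<open>m choose Suc m\<close> is 0 as well.\<close>
  proof (cases "k = m")
    case False
    then have "Suc k \<le> m" using assms by simp
    then have "Suc j = m - k \<longleftrightarrow> j = m - Suc k" for j
      by auto
    then have "(\<Sum>j\<le>m. if Suc j = m - k then of_nat (m choose k) * of_nat (m choose j) else 0) =
        (of_nat (m choose k) * of_nat (m choose (m - Suc k)) :: complex)"
      by (simp only: sum.delta finite_atMost atMost_iff diff_le_self if_True)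
    then show ?thesis
      by (simp only: binomial_symmetric[OF \<open>Suc k \<le> m\<close>])
  qed simp
  finally show ?thesis .
qed

section \<open>Vanishing on \<open>P^m\<close> and nonvanishing on \<open>Q * P^m\<close>\<close>

lemma fact_fact_choose:
  assumes "k \<le> m"
  shows "fact k * fact (m - k) * of_nat (m choose k) = (fact m :: complex)"
  using arg_cong[OF binomial_fact_lemma[OF assms], of "of_nat :: nat \<Rightarrow> complex"]
  by (simp only: of_nat_mult of_nat_fact)

lemma cubic_op_funpow_cubic_power:
  assumes "m \<ge> 1"
  shows "(cubic_op ^^ m) (cubic ^ m) = 0"
proof (rule poly_eq_0_if_dcoeff[where n = 5])
  fix \<beta>
  let ?g = "\<lambda>k. exps5 k (m - k) (m - k) k m"
  show "dcoeff 5 ((cubic_op ^^ m) (cubic ^ m)) \<beta> = 0"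
  proof (cases "\<beta> = 0")
    case True
    have "dcoeff 5 ((cubic_op ^^ m) (cubic ^ m)) \<beta> =
        (\<Sum>k\<le>m. (-1) ^ m * fact m ^ 3 * ((-1) ^ k * of_nat (m choose k)))"
      unfolding dcoeff_cubic_op_funpow True
    proof (intro sum.cong refl)
      fix k assume "k \<in> {..m}"
      then have k: "k \<le> m" by simp
      \<comment> \<open>The exponents \<open>k\<close> and \<open>m - k\<close> each occur twice and
        \<open>m choose (m - k)\<close> equals \<open>m choose k\<close>, hence the square;
        \<open>fact m\<close> is the weight of t.\<close>
      have "dcoeff 5 (cubic ^ m) (0 + ?g k) =
          (fact k * fact (m - k) * of_nat (m choose k)) ^ 2 * fact m"
        using k by (simp add: dcoeff_exps5 lookup_cubic_power binomial_symmetric[OF k, symmetric] power2_eq_square)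
      then show "(-1) ^ (m + k) * of_nat (m choose k) * dcoeff 5 (cubic ^ m) (0 + ?g k) =
          (-1) ^ m * fact m ^ 3 * ((-1) ^ k * of_nat (m choose k))"
        unfolding fact_fact_choose[OF k] by (simp add: power_add power2_eq_square power3_eq_cube)
    qed
    also have "\<dots> = (-1) ^ m * fact m ^ 3 * (\<Sum>k\<le>m. (-1) ^ k * of_nat (m choose k))"
      by (simp add: sum_distrib_left)
    finally show ?thesis
      using assms by (simp add: choose_alternating_sum)
  next
    case False
    have "Poly_Mapping.lookup (cubic ^ m) (\<beta> + ?g k) = 0" if k: "k \<le> m" for k
    proof (rule ccontr)
      assume nz: "Poly_Mapping.lookup (cubic ^ m) (\<beta> + ?g k) \<noteq> 0"
      then obtain p q r s u where \<beta>: "\<beta> = exps5 p q r s u"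
        by (metis lookup_cubic_power_nonzeroE add_exps5_eq_exps5E)
      \<comment> \<open>The support conditions reduce to \<open>p + q = 0\<close>,
        \<open>s = p\<close> and \<open>r + u = q\<close>, which leave only \<beta> = 0.\<close>
      have "p + k + (q + (m - k)) = m" "s + k = p + k"
        "r + (m - k) + (u + m) = m + (q + (m - k))"
        using nz by (auto simp: \<beta> exps5_add lookup_cubic_power split: if_splits)
      then have "p = 0" "q = 0" "r = 0" "s = 0" "u = 0"
        using k by auto
      then show False
        using False by (simp add: \<beta> exps5_0)
    qed
    then show ?thesis
      unfolding dcoeff_cubic_op_funpow by (simp add: dcoeff_def)
  qed
qed

text \<open>\<open>Q * P^m\<close> has degree \<open>3m + 1\<close> and \<Lambda>^m lowers degrees
  by \<open>3m\<close>, so the result is a linear form; one nonzero coefficient, that of t,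
  suffices.\<close>

lemma dcoeff_cubic_op_funpow_X_cubic_power:
  assumes "m \<ge> 1"
  shows "dcoeff 5 ((cubic_op ^^ m) (X 2 * cubic ^ m)) (exps5 0 0 0 0 1) =
    (-1) ^ m * fact m ^ 2 * fact (Suc m)"
proof -
  let ?\<alpha> = "\<lambda>k. exps5 0 0 0 0 1 + exps5 k (m - k) (m - k) k m"
  have "dcoeff 5 ((cubic_op ^^ m) (X 2 * cubic ^ m)) (exps5 0 0 0 0 1) =
      (\<Sum>k\<le>m. (-1) ^ m * fact m ^ 2 * fact (Suc m) * ((-1) ^ k * of_nat (m choose Suc k)))"
    unfolding dcoeff_cubic_op_funpow
  proof (intro sum.cong refl)
    fix k assume "k \<in> {..m}"
    then have k: "k \<le> m" by simp
    have "Poly_Mapping.lookup (X 2 * cubic ^ m) (?\<alpha> k) =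
        of_nat (m choose k) * of_nat (m choose Suc k)"
      using lookup_X_mult_cubic_power[OF k] by (simp add: exps5_add)
    \<comment> \<open>The binomial of the operator expansion joins the one from the coefficient to
      complete the square; \<open>fact (Suc m)\<close> comes from the exponent of t.\<close>
    then have "of_nat (m choose k) * dcoeff 5 (X 2 * cubic ^ m) (?\<alpha> k) =
        (fact k * fact (m - k) * of_nat (m choose k)) ^ 2 * fact (Suc m) * of_nat (m choose Suc k)"
      by (simp add: exps5_add dcoeff_exps5 power2_eq_square)
    then show "(-1) ^ (m + k) * of_nat (m choose k) * dcoeff 5 (X 2 * cubic ^ m) (?\<alpha> k) =
        (-1) ^ m * fact m ^ 2 * fact (Suc m) * ((-1) ^ k * of_nat (m choose Suc k))"
      unfolding fact_fact_choose[OF k] by (simp only: power_add mult.assoc) (simp add: mult_ac)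
  qed
  also have "\<dots> = (-1) ^ m * fact m ^ 2 * fact (Suc m) * (\<Sum>k\<le>m. (-1) ^ k * of_nat (m choose Suc k))"
    by (simp add: sum_distrib_left)
  also have "(\<Sum>k\<le>m. (-1) ^ k * of_nat (m choose Suc k)) = (1 :: complex)"
  proof -
    \<comment> \<open>Extending the range to \<open>Suc m\<close> adds only a zero term; splitting
      off \<open>k = 0\<close> then isolates the 1.\<close>
    have "0 = (\<Sum>k\<le>Suc m. (-1) ^ k * of_nat (m choose k) :: complex)"
      using assms choose_alternating_sum[of m, where 'a = complex] by simp
    also have "\<dots> = 1 - (\<Sum>k\<le>m. (-1) ^ k * of_nat (m choose Suc k))"
      by (simp only: sum.atMost_Suc_shift) (simp add: sum_negf)
    finally show ?thesis by simp
  qed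
  finally show ?thesis by simp
qed

section \<open>Membership in the polynomial ring and the operator algebra, and the
  counterexample\<close>

lemma X_in_polys: "i < n \<Longrightarrow> X i \<in> polys n"
  by (simp add: X_def polys_def)

lemma add_in_polys: "p \<in> polys n \<Longrightarrow> q \<in> polys n \<Longrightarrow> p + q \<in> polys n"
  using Poly_Mapping.keys_add[of p q] by (auto simp: polys_def)

lemma mult_in_polys:
  assumes "p \<in> polys n" "q \<in> polys n"
  shows "p * q \<in> polys n"
  unfolding polys_def
proof (intro CollectI ballI)
  fix \<alpha> assume "\<alpha> \<in> Poly_Mapping.keys (p * q)"
  then obtain \<beta> \<gamma> where "\<alpha> = \<beta> + \<gamma>" "\<beta> \<in> Poly_Mapping.keys p" "\<gamma> \<in> Poly_Mapping.keys q"
    using keys_mult[of p q] by auto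
  then show "Poly_Mapping.keys \<alpha> \<subseteq> {..<n}"
    using assms Poly_Mapping.keys_add[of \<beta> \<gamma>] unfolding polys_def by blast
qed

lemma diff_in_diff_ops:
  assumes "D \<in> diff_ops n" "E \<in> diff_ops n"
  shows "(\<lambda>f. D f - E f) \<in> diff_ops n"
proof -
  have "Const (-1) * f = - f" for f
    by (simp add: Const_def single_uminus)
  then have "(\<lambda>f. D f - E f) = (\<lambda>f. D f + ((\<lambda>f. Const (-1) * f) \<circ> E) f)"
    by (simp add: fun_eq_iff)
  then show ?thesis
    using assms by (simp only: diff_ops.intros)
qed

lemma cubic_op_in_diff_ops: "cubic_op \<in> diff_ops 5"
proof -
  have "pd 4 \<circ> (\<lambda>f. (pd 0 \<circ> pd 3) f - (pd 1 \<circ> pd 2) f) \<in> diff_ops 5"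
    by (intro diff_ops.comp diff_in_diff_ops diff_ops.partial) simp_all
  then show ?thesis by (simp add: comp_def cubic_op_def[abs_def])
qed

theorem theorem1p1:
  fixes a b c d t P Q :: cpoly
    and Da Db Dc Dd Dt \<Lambda> :: "cpoly \<Rightarrow> cpoly"
  assumes "a = X 0" and "b = X 1" and "c = X 2" and "d = X 3" and "t = X 4"
    and "Da = pd 0" and "Db = pd 1" and "Dc = pd 2" and "Dd = pd 3" and "Dt = pd 4"
    and "P = (t + c) * (a * d + b * t)"
    and "Q = c"
    and "\<Lambda> = (\<lambda>f. Dt (Da (Dd f) - Db (Dc f)))"
  shows "(\<forall>m\<ge>1. (\<Lambda> ^^ m) (P ^ m) = 0)
       \<and> (\<forall>m\<ge>1. (\<Lambda> ^^ m) (Q * P ^ m) \<noteq> 0)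
       \<and> \<not> generalized_vanishing_conjecture 5"
proof -
  have \<Lambda>: "\<Lambda> = cubic_op" and P: "P = cubic" and Q: "Q = X 2"
    using assms by (simp_all add: cubic_op_def[abs_def] cubic_def)
  have zero: "\<forall>m\<ge>1. (\<Lambda> ^^ m) (P ^ m) = 0"
    unfolding \<Lambda> P using cubic_op_funpow_cubic_power by blast
  have nonzero: "(\<Lambda> ^^ m) (Q * P ^ m) \<noteq> 0" if "m \<ge> 1" for m
  proof
    assume "(\<Lambda> ^^ m) (Q * P ^ m) = 0"
    then show False
      using dcoeff_cubic_op_funpow_X_cubic_power[OF that]
      \<comment> \<open>Left folded, \<open>fact (Suc m)\<close> is visibly nonzero, whereas
        unfolding would leave a complex factor \<open>1 + of_nat m\<close> to refute.\<close>
      unfolding \<Lambda> P Q by (simp add: dcoeff_def del: fact_Suc)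
  qed
  have "\<not> generalized_vanishing_conjecture 5"
  proof
    assume "generalized_vanishing_conjecture 5"
    moreover have "\<Lambda> \<in> diff_ops 5" "P \<in> polys 5" "Q \<in> polys 5"
      unfolding \<Lambda> P Q cubic_def by (intro cubic_op_in_diff_ops mult_in_polys add_in_polys X_in_polys; simp)+
    ultimately have "eventually (\<lambda>m. (\<Lambda> ^^ m) (Q * P ^ m) = 0) sequentially"
      using zero unfolding generalized_vanishing_conjecture_def by blast
    then obtain N where "\<And>m. m \<ge> N \<Longrightarrow> (\<Lambda> ^^ m) (Q * P ^ m) = 0"
      by (auto simp: eventually_sequentially)
    then show False
      using nonzero[of "max N 1"] by simp
  qed
  with zero nonzero show ?thesis by blast
qed

end
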